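(* Up to $\mathrm{S5}$-equivalence there are exactly four $\mathrm{S5}$-additive formulas without parameters (i.e. formulas in $\mathrm{Fm}(p)$): $\bot$, $p$, $\Diamond p$, and $\top$. Exactly three of them are normal in $\mathrm{S5}$: $\bot$, $p$, and $\Diamond p$.
   Context: $\mathrm{Fm}(p)$ is the set of modal formulas (built with Boolean connectives, $\bot,\top,\Diamond,\Box$) containing no variables other than $p$. For a normal modal logic $\Lambda$, formulas $\varphi,\psi$ are $\Lambda$-equivalent if $\Lambda\vdash\varphi\leftrightarrow\psi$. A formula $\varphi(p)$ is $\Lambda$-additive if $\Lambda\vdash\varphi(p\vee q)\leftrightarrow\varphi(p)\vee\varphi(q)$ (with $q$ a variable distinct from $p$), and normal in $\Lambda$ if $\Lambda\vdash\varphi(\bot)\leftrightarrow\bot$. $\mathrm{S5}$ is the usual normal modal logic of frames whose relation is an equivalence relation. *)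

theory Defs
  imports Main "HOL-Library.Nat_Bijection"
begin

datatype fm =
    Var nat
  | Bot
  | Top
  | Neg fm
  | Conj fm fm
  | Disj fm fm
  | Imp fm fm
  | Dia fm
  | Box fm

definition Iff :: "fm \<Rightarrow> fm \<Rightarrow> fm" where
  "Iff \<phi> \<psi> = Conj (Imp \<phi> \<psi>) (Imp \<psi> \<phi>)"

primrec vars :: "fm \<Rightarrow> nat set" where
  "vars (Var x) = {x}"
| "vars Bot = {}"
| "vars Top = {}"
| "vars (Neg \<phi>) = vars \<phi>"
| "vars (Conj \<phi> \<psi>) = vars \<phi> \<union> vars \<psi>"
| "vars (Disj \<phi> \<psi>) = vars \<phi> \<union> vars \<psi>"
| "vars (Imp \<phi> \<psi>) = vars \<phi> \<union> vars \<psi>"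
| "vars (Dia \<phi>) = vars \<phi>"
| "vars (Box \<phi>) = vars \<phi>"

definition Fm :: "nat \<Rightarrow> fm set" where
  "Fm p = {\<phi>. vars \<phi> \<subseteq> {p}}"

primrec subst :: "(nat \<Rightarrow> fm) \<Rightarrow> fm \<Rightarrow> fm" where
  "subst s (Var x) = s x"
| "subst s Bot = Bot"
| "subst s Top = Top"
| "subst s (Neg \<phi>) = Neg (subst s \<phi>)"
| "subst s (Conj \<phi> \<psi>) = Conj (subst s \<phi>) (subst s \<psi>)"
| "subst s (Disj \<phi> \<psi>) = Disj (subst s \<phi>) (subst s \<psi>)"
| "subst s (Imp \<phi> \<psi>) = Imp (subst s \<phi>) (subst s \<psi>)"
| "subst s (Dia \<phi>) = Dia (subst s \<phi>)"
| "subst s (Box \<phi>) = Box (subst s \<phi>)"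

text \<open>For a formula \<open>\<phi>(p)\<close>, the formula \<open>\<phi>(\<psi>)\<close> is \<open>inst p \<psi> \<phi>\<close>.\<close>

definition inst :: "nat \<Rightarrow> fm \<Rightarrow> fm \<Rightarrow> fm" where
  "inst p \<psi> \<phi> = subst (Var(p := \<psi>)) \<phi>"


section \<open>Notions relative to a logic\<close>

text \<open>A logic is identified with its set of theorems, so that derivability in
  \<open>\<Lambda>\<close> is membership in \<open>\<Lambda>\<close>. In \<open>tautology\<close>, modal formulas
  are treated as atoms.\<close>

definition tautology :: "fm \<Rightarrow> bool" where
  "tautology \<phi> \<longleftrightarrow> (\<forall>e :: fm \<Rightarrow> bool.
     \<not> e Bot \<and> e Top \<and>
     (\<forall>\<psi>. e (Neg \<psi>) \<longleftrightarrow> \<not> e \<psi>) \<and>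
     (\<forall>\<psi> \<chi>. e (Conj \<psi> \<chi>) \<longleftrightarrow> e \<psi> \<and> e \<chi>) \<and>
     (\<forall>\<psi> \<chi>. e (Disj \<psi> \<chi>) \<longleftrightarrow> e \<psi> \<or> e \<chi>) \<and>
     (\<forall>\<psi> \<chi>. e (Imp \<psi> \<chi>) \<longleftrightarrow> (e \<psi> \<longrightarrow> e \<chi>))
     \<longrightarrow> e \<phi>)"

definition normal_logic :: "fm set \<Rightarrow> bool" where
  "normal_logic \<Lambda> \<longleftrightarrow>
     {\<phi>. tautology \<phi>} \<subseteq> \<Lambda> \<and>
     (\<forall>\<phi> \<psi>. Imp (Box (Imp \<phi> \<psi>)) (Imp (Box \<phi>) (Box \<psi>)) \<in> \<Lambda>) \<and>
     (\<forall>\<phi>. Iff (Dia \<phi>) (Neg (Box (Neg \<phi>))) \<in> \<Lambda>) \<and>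
     (\<forall>\<phi> \<psi>. Imp \<phi> \<psi> \<in> \<Lambda> \<longrightarrow> \<phi> \<in> \<Lambda> \<longrightarrow> \<psi> \<in> \<Lambda>) \<and>
     (\<forall>\<phi>. \<phi> \<in> \<Lambda> \<longrightarrow> Box \<phi> \<in> \<Lambda>) \<and>
     (\<forall>s \<phi>. \<phi> \<in> \<Lambda> \<longrightarrow> subst s \<phi> \<in> \<Lambda>)"

definition equivalent :: "fm set \<Rightarrow> fm \<Rightarrow> fm \<Rightarrow> bool" where
  "equivalent \<Lambda> \<phi> \<psi> \<longleftrightarrow> Iff \<phi> \<psi> \<in> \<Lambda>"

text \<open>The notion is meant for \<open>q \<noteq> p\<close> and \<open>q\<close> not occurring in \<open>\<phi>\<close>.\<close>

definition additive :: "fm set \<Rightarrow> nat \<Rightarrow> nat \<Rightarrow> fm \<Rightarrow> bool" where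
  "additive \<Lambda> p q \<phi> \<longleftrightarrow>
     Iff (inst p (Disj (Var p) (Var q)) \<phi>) (Disj (inst p (Var p) \<phi>) (inst p (Var q) \<phi>)) \<in> \<Lambda>"

definition normal_in :: "fm set \<Rightarrow> nat \<Rightarrow> fm \<Rightarrow> bool" where
  "normal_in \<Lambda> p \<phi> \<longleftrightarrow> Iff (inst p Bot \<phi>) Bot \<in> \<Lambda>"

text \<open>Up to \<open>\<Lambda>\<close>-equivalence, the elements of \<open>X\<close> are exactly the formulas in
  \<open>S\<close>, and these are pairwise distinct up to \<open>\<Lambda>\<close>-equivalence.\<close>

definition representatives :: "fm set \<Rightarrow> fm set \<Rightarrow> fm set \<Rightarrow> bool" where
  "representatives \<Lambda> X S \<longleftrightarrow>
     S \<subseteq> X \<and>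
     (\<forall>\<phi>\<in>X. \<exists>\<psi>\<in>S. equivalent \<Lambda> \<phi> \<psi>) \<and>
     (\<forall>\<phi>\<in>S. \<forall>\<psi>\<in>S. \<phi> \<noteq> \<psi> \<longrightarrow> \<not> equivalent \<Lambda> \<phi> \<psi>)"


section \<open>Kripke semantics and S5\<close>

primrec sat :: "'w rel \<Rightarrow> (nat \<Rightarrow> 'w set) \<Rightarrow> 'w \<Rightarrow> fm \<Rightarrow> bool" where
  "sat R V w (Var x) \<longleftrightarrow> w \<in> V x"
| "sat R V w Bot \<longleftrightarrow> False"
| "sat R V w Top \<longleftrightarrow> True"
| "sat R V w (Neg \<phi>) \<longleftrightarrow> \<not> sat R V w \<phi>"
| "sat R V w (Conj \<phi> \<psi>) \<longleftrightarrow> sat R V w \<phi> \<and> sat R V w \<psi>"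
| "sat R V w (Disj \<phi> \<psi>) \<longleftrightarrow> sat R V w \<phi> \<or> sat R V w \<psi>"
| "sat R V w (Imp \<phi> \<psi>) \<longleftrightarrow> (sat R V w \<phi> \<longrightarrow> sat R V w \<psi>)"
| "sat R V w (Dia \<phi>) \<longleftrightarrow> (\<exists>v. (w, v) \<in> R \<and> sat R V v \<phi>)"
| "sat R V w (Box \<phi>) \<longleftrightarrow> (\<forall>v. (w, v) \<in> R \<longrightarrow> sat R V v \<phi>)"

definition frame_valid :: "'w set \<Rightarrow> 'w rel \<Rightarrow> fm \<Rightarrow> bool" where
  "frame_valid W R \<phi> \<longleftrightarrow> (\<forall>V. (\<forall>x. V x \<subseteq> W) \<longrightarrow> (\<forall>w\<in>W. sat R V w \<phi>))"

text \<open>The logic of all frames whose relation is an equivalence relation. A definition cannot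
  quantify over types, so the worlds are drawn from \<^typ>\<open>nat\<close>; by \<open>S5_valid\<close> below
  this is no restriction, as the formulas in \<open>S5\<close> are valid in the equivalence frames over
  every type.\<close>

definition S5 :: "fm set" where
  "S5 = {\<phi>. \<forall>(W :: nat set) R. equiv W R \<longrightarrow> frame_valid W R \<phi>}"

lemma finite_vars: "finite (vars \<phi>)"
  by (induction \<phi>) auto

lemma S5_valid:
  fixes W :: "'w set"
  assumes "\<phi> \<in> S5" and eq: "equiv W R"
  shows "frame_valid W R \<phi>"
  unfolding frame_valid_def
proof (intro allI impI ballI)
  fix V :: "nat \<Rightarrow> 'w set" and w assume w: "w \<in> W"
  define C where "C = R `` {w}"
  define h where "h u = set_encode {x \<in> vars \<phi>. u \<in> V x}" for u
  define V' where "V' x = h ` (C \<inter> V x)" for x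
  let ?R = "(h ` C) \<times> (h ` C)"
  have C: "(u, v) \<in> R \<longleftrightarrow> v \<in> C" if "u \<in> C" for u v
    using that eq unfolding C_def equiv_def by (blast dest: symD transD)
  have h: "u \<in> V x \<longleftrightarrow> v \<in> V x" if "h u = h v" "x \<in> vars \<phi>" for u v x
  proof -
    have "{x \<in> vars \<phi>. u \<in> V x} = {x \<in> vars \<phi>. v \<in> V x}"
      using that(1) unfolding h_def by (simp add: set_encode_eq finite_vars)
    with that(2) show ?thesis by blast
  qed
  have sat: "sat R V u \<psi> \<longleftrightarrow> sat ?R V' (h u) \<psi>" if "u \<in> C" "vars \<psi> \<subseteq> vars \<phi>" for u \<psi>
    using that
  proof (induction \<psi> arbitrary: u)
    case (Var x)
    then show ?case by (auto simp: V'_def dest: h)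
  next
    case (Dia \<psi>)
    then show ?case by (auto simp: C)
  next
    case (Box \<psi>)
    then show ?case by (auto simp: C)
  qed auto
  have wC: "w \<in> C"
    using w eq by (auto simp: C_def equiv_def dest: refl_onD)
  have "equiv (h ` C) ?R"
    by (auto intro!: equivI refl_onI symI transI)
  then have "frame_valid (h ` C) ?R \<phi>"
    using assms(1) by (auto simp: S5_def)
  moreover have "\<forall>x. V' x \<subseteq> h ` C"
    by (auto simp: V'_def)
  ultimately show "sat R V w \<phi>"
    using sat[OF wC subset_refl] wC unfolding frame_valid_def by blast
qed

lemma sat_subst:
  assumes "equiv W R" "w \<in> W"
  shows "sat R V w (subst s \<phi>) \<longleftrightarrow> sat R (\<lambda>x. {v \<in> W. sat R V v (s x)}) w \<phi>"
  using assms(2)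
proof (induction \<phi> arbitrary: w)
  case (Dia \<phi>)
  have "v \<in> W" if "(w, v) \<in> R" for v
    using that assms(1) by (auto simp: equiv_def)
  then have "(\<exists>v. (w, v) \<in> R \<and> sat R V v (subst s \<phi>)) \<longleftrightarrow>
      (\<exists>v. (w, v) \<in> R \<and> sat R (\<lambda>x. {v \<in> W. sat R V v (s x)}) v \<phi>)"
    using Dia.IH by blast
  then show ?case by simp
next
  case (Box \<phi>)
  have "v \<in> W" if "(w, v) \<in> R" for v
    using that assms(1) by (auto simp: equiv_def)
  then have "(\<forall>v. (w, v) \<in> R \<longrightarrow> sat R V v (subst s \<phi>)) \<longleftrightarrow>
      (\<forall>v. (w, v) \<in> R \<longrightarrow> sat R (\<lambda>x. {v \<in> W. sat R V v (s x)}) v \<phi>)"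
    using Box.IH by blast
  then show ?case by simp
qed auto

lemma normal_logic_S5: "normal_logic S5"
  unfolding normal_logic_def
proof (intro conjI allI impI subsetI)
  fix \<phi> assume "\<phi> \<in> {\<phi>. tautology \<phi>}"
  then have t: "tautology \<phi>" by simp
  have "sat R V w \<phi>" for R and V :: "nat \<Rightarrow> nat set" and w
    using t[unfolded tautology_def, rule_format, of "sat R V w"] by auto
  then show "\<phi> \<in> S5" by (auto simp: S5_def frame_valid_def)
next
  fix s \<phi> assume *: "\<phi> \<in> S5"
  show "subst s \<phi> \<in> S5"
    unfolding S5_def frame_valid_def
  proof (clarify)
    fix W :: "nat set" and R and V :: "nat \<Rightarrow> nat set" and w
    assume R: "equiv W R" and w: "w \<in> W"
    show "sat R V w (subst s \<phi>)"
      using * R w by (auto simp: sat_subst[OF R w] S5_def frame_valid_def)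
  qed
next
  fix \<phi> assume \<phi>: "\<phi> \<in> S5"
  show "Box \<phi> \<in> S5"
    unfolding S5_def frame_valid_def
  proof (clarify)
    fix W :: "nat set" and R and V :: "nat \<Rightarrow> nat set" and w
    assume R: "equiv W R" and V: "\<forall>x. V x \<subseteq> W" and w: "w \<in> W"
    have "v \<in> W" if "(w, v) \<in> R" for v
      using that R by (auto simp: equiv_def)
    moreover have "sat R V v \<phi>" if "v \<in> W" for v
      using \<phi> R V that by (simp add: S5_def frame_valid_def)
    ultimately show "sat R V w (Box \<phi>)" by simp
  qed
next
  fix \<phi> \<psi> assume "Imp \<phi> \<psi> \<in> S5" "\<phi> \<in> S5"
  then show "\<psi> \<in> S5" by (simp add: S5_def frame_valid_def)
qed (simp_all add: S5_def frame_valid_def Iff_def)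

end

(* In a pointed S5 model (C, w) with C a single cluster and A the extension of p in C, the truth of
   a formula in p alone depends only on the three bits "w is in A", "A is nonempty", "A is not C",
   hence on which of four cases holds:
     (a) A is empty;  (b) A = C;  (c) w in A and A is not C;  (d) w not in A and A is nonempty.
   A formula is thus a set of cases. Additivity in a three-element cluster says that (a) brings in
   all other cases (union with the empty set), (d) brings in (c), and (b) is present iff (c) or (d)
   is (unions of a set containing w with one avoiding it). The solutions are: all cases (Top),
   none (Bot), {b, c} (p) and {b, c, d} (Dia p). *)
theory Submission
  imports Defs
begin

text \<open>The parameters \<open>x\<close>, \<open>y\<close>, \<open>z\<close> stand for the truth values of \<open>p\<close>, \<open>\<Diamond>p\<close>, \<open>\<Diamond>\<not>p\<close> at the
  current world; only those with \<open>x \<longrightarrow> y\<close> and \<open>\<not> x \<longrightarrow> z\<close> occur in reflexive models.\<close>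

primrec truth :: "bool \<Rightarrow> bool \<Rightarrow> bool \<Rightarrow> fm \<Rightarrow> bool" where
  "truth x y z (Var v) \<longleftrightarrow> x"
| "truth x y z Bot \<longleftrightarrow> False"
| "truth x y z Top \<longleftrightarrow> True"
| "truth x y z (Neg \<phi>) \<longleftrightarrow> \<not> truth x y z \<phi>"
| "truth x y z (Conj \<phi> \<psi>) \<longleftrightarrow> truth x y z \<phi> \<and> truth x y z \<psi>"
| "truth x y z (Disj \<phi> \<psi>) \<longleftrightarrow> truth x y z \<phi> \<or> truth x y z \<psi>"
| "truth x y z (Imp \<phi> \<psi>) \<longleftrightarrow> (truth x y z \<phi> \<longrightarrow> truth x y z \<psi>)"
| "truth x y z (Dia \<phi>) \<longleftrightarrow> y \<and> truth True y z \<phi> \<or> z \<and> truth False y z \<phi>"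
| "truth x y z (Box \<phi>) \<longleftrightarrow> (y \<longrightarrow> truth True y z \<phi>) \<and> (z \<longrightarrow> truth False y z \<phi>)"

text \<open>Since \<open>T\<close> sees \<open>v\<close> only through the Boolean
  \<open>Q v\<close>, one witness per value suffices. In the diamond case below, \<open>Q v\<close>
  is the truth of the substituted formula at the successor \<open>v\<close>.\<close>

lemma ex_bool_split:
  "(\<exists>v. P v \<and> T (Q v)) \<longleftrightarrow> (\<exists>v. P v \<and> Q v) \<and> T True \<or> (\<exists>v. P v \<and> \<not> Q v) \<and> T False"
proof -
  have "T (Q v) \<longleftrightarrow> Q v \<and> T True \<or> \<not> Q v \<and> T False" for v
    by (cases "Q v") simp_all
  then show ?thesis by blast
qed

lemma all_bool_split:
  "(\<forall>v. P v \<longrightarrow> T (Q v)) \<longleftrightarrow> ((\<exists>v. P v \<and> Q v) \<longrightarrow> T True) \<and> ((\<exists>v. P v \<and> \<not> Q v) \<longrightarrow> T False)"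
  using ex_bool_split[of P "\<lambda>b. \<not> T b" Q] by blast

text \<open>Induction on \<open>\<phi>\<close>: passing to a successor stays in the cluster, so it
  can change the first bit but not the other two.\<close>

lemma sat_inst:
  assumes "sym R" "trans R" "\<phi> \<in> Fm p"
  shows "sat R V w (inst p \<psi> \<phi>) \<longleftrightarrow>
    truth (sat R V w \<psi>) (\<exists>v. (w, v) \<in> R \<and> sat R V v \<psi>) (\<exists>v. (w, v) \<in> R \<and> \<not> sat R V v \<psi>) \<phi>"
proof -
  have cluster: "(v, u) \<in> R \<longleftrightarrow> (w, u) \<in> R" if "(w, v) \<in> R" for u v w
    using that assms(1,2) by (blast dest: symD transD)
  have step: "truth (sat R V v \<psi>) (\<exists>u. (v, u) \<in> R \<and> sat R V u \<psi>)
        (\<exists>u. (v, u) \<in> R \<and> \<not> sat R V u \<psi>) \<chi> \<longleftrightarrow>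
      truth (sat R V v \<psi>) (\<exists>u. (w, u) \<in> R \<and> sat R V u \<psi>)
        (\<exists>u. (w, u) \<in> R \<and> \<not> sat R V u \<psi>) \<chi>" if "(w, v) \<in> R" for v w \<chi>
    using cluster[OF that] by simp
  have "vars \<phi> \<subseteq> {p}" using assms(3) by (simp add: Fm_def)
  then show ?thesis
  proof (induction \<phi> arbitrary: w)
    case (Dia \<chi>)
    let ?t = "\<lambda>x. truth x (\<exists>u. (w, u) \<in> R \<and> sat R V u \<psi>) (\<exists>u. (w, u) \<in> R \<and> \<not> sat R V u \<psi>) \<chi>"
    have "sat R V v (inst p \<psi> \<chi>) \<longleftrightarrow> ?t (sat R V v \<psi>)" if "(w, v) \<in> R" for v
      using Dia.IH[of v] Dia.prems step[OF that] by simp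
    then have "sat R V w (inst p \<psi> (Dia \<chi>)) \<longleftrightarrow> (\<exists>v. (w, v) \<in> R \<and> ?t (sat R V v \<psi>))"
      by (auto simp: inst_def)
    also have "\<dots> \<longleftrightarrow> (\<exists>v. (w, v) \<in> R \<and> sat R V v \<psi>) \<and> ?t True \<or>
        (\<exists>v. (w, v) \<in> R \<and> \<not> sat R V v \<psi>) \<and> ?t False"
      by (rule ex_bool_split)
    finally show ?case by simp
  next
    case (Box \<chi>)
    let ?t = "\<lambda>x. truth x (\<exists>u. (w, u) \<in> R \<and> sat R V u \<psi>) (\<exists>u. (w, u) \<in> R \<and> \<not> sat R V u \<psi>) \<chi>"
    have "sat R V v (inst p \<psi> \<chi>) \<longleftrightarrow> ?t (sat R V v \<psi>)" if "(w, v) \<in> R" for v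
      using Box.IH[of v] Box.prems step[OF that] by simp
    then have "sat R V w (inst p \<psi> (Box \<chi>)) \<longleftrightarrow> (\<forall>v. (w, v) \<in> R \<longrightarrow> ?t (sat R V v \<psi>))"
      by (auto simp: inst_def)
    also have "\<dots> \<longleftrightarrow> ((\<exists>v. (w, v) \<in> R \<and> sat R V v \<psi>) \<longrightarrow> ?t True) \<and>
        ((\<exists>v. (w, v) \<in> R \<and> \<not> sat R V v \<psi>) \<longrightarrow> ?t False)"
      by (rule all_bool_split)
    finally show ?case by simp
  qed (auto simp: inst_def)
qed

lemma inst_Var [simp]: "inst p (Var p) \<phi> = \<phi>"
proof -
  have "subst Var \<phi> = \<phi>" by (induction \<phi>) auto
  then show ?thesis by (simp add: inst_def)
qed

lemma sat_truth:
  assumes "sym R" "trans R" "\<phi> \<in> Fm p"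
  shows "sat R V w \<phi> \<longleftrightarrow>
    truth (w \<in> V p) (\<exists>v. (w, v) \<in> R \<and> v \<in> V p) (\<exists>v. (w, v) \<in> R \<and> v \<notin> V p) \<phi>"
  using sat_inst[OF assms, of V w "Var p"] by simp

text \<open>The universal relation turns a whole type into one cluster, so small types can serve as
  test models although \<open>S5\<close> is defined over \<open>nat\<close>.\<close>

lemma S5_sat_UNIV:
  fixes w :: 'w
  assumes "\<phi> \<in> S5"
  shows "sat UNIV V w \<phi>"
proof -
  have "equiv UNIV (UNIV :: 'w rel)"
    by (auto intro!: equivI refl_onI symI transI)
  from S5_valid[OF assms this] show ?thesis
    by (simp add: frame_valid_def)
qed

lemma sym_UNIV: "sym UNIV" and trans_UNIV: "trans UNIV"
  by (auto intro: symI transI)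

lemma Fm_Iff: "Iff \<phi> \<psi> \<in> Fm p \<longleftrightarrow> \<phi> \<in> Fm p \<and> \<psi> \<in> Fm p"
  by (auto simp: Fm_def Iff_def)

text \<open>Reflexivity imposes the two constraints on the bits, and every triple obeying them
  already occurs in a two-world cluster.\<close>

lemma S5_iff_truth:
  assumes \<phi>: "\<phi> \<in> Fm p"
  shows "\<phi> \<in> S5 \<longleftrightarrow> (\<forall>x y z. (x \<longrightarrow> y) \<longrightarrow> (\<not> x \<longrightarrow> z) \<longrightarrow> truth x y z \<phi>)"
proof (intro iffI allI impI)
  fix x y z :: bool
  assume "\<phi> \<in> S5" and xyz: "x \<longrightarrow> y" "\<not> x \<longrightarrow> z"
  \<comment> \<open>The world \<open>True\<close> realizes \<open>\<Diamond>p\<close> if possible and \<open>False\<close> realizes \<open>\<Diamond>\<not>p\<close> if possible.\<close>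
  define V :: "nat \<Rightarrow> bool set" where "V = (\<lambda>_. {v. v \<and> y \<or> \<not> v \<and> \<not> z})"
  have "sat UNIV V x \<phi>"
    using \<open>\<phi> \<in> S5\<close> by (rule S5_sat_UNIV)
  moreover have "x \<in> V p \<longleftrightarrow> x" "(\<exists>v. v \<in> V p) \<longleftrightarrow> y" "(\<exists>v. v \<notin> V p) \<longleftrightarrow> z"
    using xyz by (auto simp: V_def)
  ultimately show "truth x y z \<phi>"
    using sat_truth[OF sym_UNIV trans_UNIV \<phi>, of V x] by simp
next
  assume t: "\<forall>x y z. (x \<longrightarrow> y) \<longrightarrow> (\<not> x \<longrightarrow> z) \<longrightarrow> truth x y z \<phi>"
  show "\<phi> \<in> S5"
    unfolding S5_def frame_valid_def
  proof (clarify)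
    fix W :: "nat set" and R and V :: "nat \<Rightarrow> nat set" and w
    assume R: "equiv W R" and w: "w \<in> W"
    then have "sym R" "trans R" "(w, w) \<in> R"
      by (auto simp: equiv_def dest: refl_onD)
    moreover from this(3) have "w \<in> V p \<longrightarrow> (\<exists>v. (w, v) \<in> R \<and> v \<in> V p)"
      "w \<notin> V p \<longrightarrow> (\<exists>v. (w, v) \<in> R \<and> v \<notin> V p)"
      by blast+
    ultimately show "sat R V w \<phi>"
      using t by (subst sat_truth[OF _ _ \<phi>]) simp_all
  qed
qed

lemma equivalent_S5_iff:
  assumes "\<phi> \<in> Fm p" "\<psi> \<in> Fm p"
  shows "equivalent S5 \<phi> \<psi> \<longleftrightarrow>
    (\<forall>x y z. (x \<longrightarrow> y) \<longrightarrow> (\<not> x \<longrightarrow> z) \<longrightarrow> (truth x y z \<phi> \<longleftrightarrow> truth x y z \<psi>))"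
  unfolding equivalent_def
  using S5_iff_truth[of "Iff \<phi> \<psi>" p] assms by (simp add: Fm_Iff) (auto simp: Iff_def)

lemma normal_in_S5_iff:
  assumes \<phi>: "\<phi> \<in> Fm p"
  shows "normal_in S5 p \<phi> \<longleftrightarrow> \<not> truth False False True \<phi>"
proof
  assume "normal_in S5 p \<phi>"
  then have "sat UNIV (\<lambda>_. {}) () (Iff (inst p Bot \<phi>) Bot)"
    unfolding normal_in_def by (rule S5_sat_UNIV)
  then show "\<not> truth False False True \<phi>"
    by (simp add: Iff_def sat_inst[OF sym_UNIV trans_UNIV \<phi>])
next
  assume n: "\<not> truth False False True \<phi>"
  show "normal_in S5 p \<phi>"
    unfolding normal_in_def S5_def frame_valid_def
  proof (clarify)
    fix W :: "nat set" and R and V :: "nat \<Rightarrow> nat set" and w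
    assume "equiv W R" and "w \<in> W"
    \<comment> \<open>The successor makes the third bit true, since \<open>Bot\<close> fails
      there.\<close>
    then have "sym R" "trans R" "\<exists>v. (w, v) \<in> R"
      by (auto simp: equiv_def dest: refl_onD)
    then show "sat R V w (Iff (inst p Bot \<phi>) Bot)"
      using n by (simp add: Iff_def sat_inst[OF _ _ \<phi>])
  qed
qed

text \<open>Taking \<open>A\<close> and \<open>B\<close> as the extensions of \<open>p\<close> and
  \<open>q\<close> turns additivity into a condition on sets that can be tested on chosen
  examples.\<close>

lemma additive_S5_truth_Un:
  fixes A B :: "'w set"
  assumes add: "additive S5 p q \<phi>" and \<phi>: "\<phi> \<in> Fm p" and "p \<noteq> q"
  defines "f \<equiv> \<lambda>X w. truth (w \<in> X) (X \<noteq> {}) (X \<noteq> UNIV) \<phi>"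
  shows "f (A \<union> B) w \<longleftrightarrow> f A w \<or> f B w"
proof -
  define V where "V = (\<lambda>_. {})(p := A, q := B)"
  have V: "V p = A" "V q = B" using \<open>p \<noteq> q\<close> by (simp_all add: V_def)
  have "sat UNIV V w (Iff (inst p (Disj (Var p) (Var q)) \<phi>) (Disj (inst p (Var p) \<phi>) (inst p (Var q) \<phi>)))"
    using add unfolding additive_def by (rule S5_sat_UNIV)
  moreover have "sat UNIV V w (inst p \<psi> \<phi>) \<longleftrightarrow> f {v. sat UNIV V v \<psi>} w" for \<psi>
  proof -
    have "(\<exists>v. sat UNIV V v \<psi>) \<longleftrightarrow> {v. sat UNIV V v \<psi>} \<noteq> {}"
      "(\<exists>v. \<not> sat UNIV V v \<psi>) \<longleftrightarrow> {v. sat UNIV V v \<psi>} \<noteq> UNIV"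
      by auto
    then show ?thesis
      by (simp add: f_def sat_inst[OF sym_UNIV trans_UNIV \<phi>])
  qed
  moreover have "{v. v \<in> A \<or> v \<in> B} = A \<union> B" by auto
  ultimately show ?thesis
    \<comment> \<open>Without \<open>inst_Var\<close>, all three instances keep the form
      \<open>inst p \<psi> \<phi>\<close> that the preceding equivalence rewrites.\<close>
    by (auto simp: Iff_def V simp del: inst_Var)
qed

lemma additive_S5_cases:
  assumes "additive S5 p q \<phi>" "\<phi> \<in> Fm p" "p \<noteq> q"
  obtains "equivalent S5 \<phi> Bot" | "equivalent S5 \<phi> (Var p)"
    | "equivalent S5 \<phi> (Dia (Var p))" | "equivalent S5 \<phi> Top"
proof -
  \<comment> \<open>The letters follow the four cases of the overview; these are the only triples
    that a reflexive model admits.\<close>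
  define a b c d where
    "a = truth False False True \<phi>" and "b = truth True True False \<phi>" and
    "c = truth True True True \<phi>" and "d = truth False True True \<phi>"
  note Un = additive_S5_truth_Un[OF assms, where 'w = "bool option"]
  \<comment> \<open>The type \<open>bool option\<close> serves as a cluster with three worlds.\<close>
  have ne: "X \<noteq> UNIV" if "Some False \<notin> X" for X :: "bool option set"
    using that by blast
  have ne': "- {None :: bool option} \<noteq> {}" "- {None :: bool option} \<noteq> UNIV"
    by (metis ComplI empty_iff option.distinct(1) singletonD, metis ComplD UNIV_I singletonI)
  have "b \<longleftrightarrow> a \<or> b"
    using Un[where A = "{}" and B = UNIV and w = None] by (simp add: a_def b_def)
  moreover have "c \<longleftrightarrow> a \<or> c"
    using Un[where A = "{}" and B = "{None}" and w = None] by (simp add: a_def c_def ne)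
  moreover have "d \<longleftrightarrow> a \<or> d"
    using Un[where A = "{}" and B = "{Some True}" and w = None] by (simp add: a_def d_def ne)
  moreover have "b \<longleftrightarrow> c \<or> d"
    using Un[where A = "{None}" and B = "- {None}" and w = None] by (simp add: b_def c_def d_def ne ne')
  moreover have "c \<longleftrightarrow> c \<or> d"
    using Un[where A = "{None}" and B = "{Some True}" and w = None] by (simp add: c_def d_def ne)
  moreover have "equivalent S5 \<phi> \<psi> \<longleftrightarrow> (a \<longleftrightarrow> truth False False True \<psi>) \<and>
      (b \<longleftrightarrow> truth True True False \<psi>) \<and> (c \<longleftrightarrow> truth True True True \<psi>) \<and>
      (d \<longleftrightarrow> truth False True True \<psi>)" if "\<psi> \<in> Fm p" for \<psi>
    unfolding equivalent_S5_iff[OF assms(2) that] a_def b_def c_def d_def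
    by (simp add: all_bool_eq) blast
  moreover have "Bot \<in> Fm p" "Var p \<in> Fm p" "Dia (Var p) \<in> Fm p" "Top \<in> Fm p"
    by (simp_all add: Fm_def)
  ultimately show thesis
    \<comment> \<open>No split on \<open>b\<close> is required, as \<open>c\<close> and
      \<open>d\<close> determine it.\<close>
    using that by (cases a; cases c; cases d) simp_all
qed

theorem corollary4p6:
  fixes p q :: nat
  assumes "p \<noteq> q"
  shows "representatives S5 {\<phi> \<in> Fm p. additive S5 p q \<phi>}
           {Bot, Var p, Dia (Var p), Top}
       \<and> card {Bot, Var p, Dia (Var p), Top} = 4
       \<and> {\<phi> \<in> {Bot, Var p, Dia (Var p), Top}. normal_in S5 p \<phi>} = {Bot, Var p, Dia (Var p)}
       \<and> representatives S5 {\<phi> \<in> Fm p. additive S5 p q \<phi> \<and> normal_in S5 p \<phi>}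
           {Bot, Var p, Dia (Var p)}
       \<and> card {Bot, Var p, Dia (Var p)} = 3"
proof -
  let ?S = "{Bot, Var p, Dia (Var p), Top}"
  have Fm: "?S \<subseteq> Fm p"
    by (simp add: Fm_def)
  have additive: "additive S5 p q \<phi>" if "\<phi> \<in> ?S" for \<phi>
    using that by (auto simp: additive_def inst_def Iff_def S5_def frame_valid_def)
  have normal: "normal_in S5 p \<phi> \<longleftrightarrow> \<phi> \<noteq> Top" if "\<phi> \<in> ?S" for \<phi>
    using that Fm normal_in_S5_iff[of \<phi> p] by auto
  have distinct: "\<not> equivalent S5 \<phi> \<psi>" if "\<phi> \<in> ?S" "\<psi> \<in> ?S" "\<phi> \<noteq> \<psi>" for \<phi> \<psi>
    using that Fm equivalent_S5_iff[of \<phi> p \<psi>] by (auto simp: all_bool_eq)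
  have equivalent: "\<exists>\<psi>\<in>?S. equivalent S5 \<phi> \<psi>" if "\<phi> \<in> Fm p" "additive S5 p q \<phi>" for \<phi>
    using that assms by (auto elim: additive_S5_cases)
  \<comment> \<open>The triple of the empty extension separates the two: a normal formula is false
    there.\<close>
  have not_normal: "\<not> equivalent S5 \<phi> Top" if "\<phi> \<in> Fm p" "normal_in S5 p \<phi>" for \<phi>
    using that Fm normal_in_S5_iff[of \<phi> p] equivalent_S5_iff[of \<phi> p Top] by auto
  have "representatives S5 {\<phi> \<in> Fm p. additive S5 p q \<phi>} ?S"
    unfolding representatives_def using Fm additive equivalent distinct by blast
  moreover have "representatives S5 {\<phi> \<in> Fm p. additive S5 p q \<phi> \<and> normal_in S5 p \<phi>}
      {Bot, Var p, Dia (Var p)}"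
  proof -
    have "\<exists>\<psi>\<in>{Bot, Var p, Dia (Var p)}. equivalent S5 \<phi> \<psi>"
      if "\<phi> \<in> Fm p" "additive S5 p q \<phi>" "normal_in S5 p \<phi>" for \<phi>
      using equivalent[OF that(1,2)] not_normal[OF that(1,3)] by blast
    moreover have "{Bot, Var p, Dia (Var p)} \<subseteq> {\<phi> \<in> Fm p. additive S5 p q \<phi> \<and> normal_in S5 p \<phi>}"
      using Fm additive normal by auto
    ultimately show ?thesis
      unfolding representatives_def using distinct by blast
  qed
  moreover have "{\<phi> \<in> ?S. normal_in S5 p \<phi>} = {Bot, Var p, Dia (Var p)}"
    using normal by auto
  ultimately show ?thesis by simp
qed

end
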